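(* Let $(G,\tau,\oplus)$ be a $P$-gyrogroup whose underlying space is Lindelöf. Then $G$ is Raĭkov complete.
   Context: A gyrogroup is a nonempty set $G$ with a binary operation $\oplus$ such that: (G1) there is a unique identity element $0\in G$ with $0\oplus a=a=a\oplus 0$ for all $a\in G$; (G2) for each $x\in G$ there is a unique inverse $\ominus x\in G$ with $\ominus x\oplus x=0=x\oplus(\ominus x)$; (G3) for all $x,y\in G$ there is an automorphism $gyr[x,y]$ of $(G,\oplus)$ (a bijective homomorphism of $(G,\oplus)$ onto itself) such that $x\oplus(y\oplus z)=(x\oplus y)\oplus gyr[x,y](z)$ for all $z\in G$; (G4) $gyr[x\oplus y,y]=gyr[x,y]$ for all $x,y\in G$. A topological gyrogroup $(G,\tau,\oplus)$ is a gyrogroup $(G,\oplus)$ with a topology $\tau$ such that $\oplus:G\times G\to G$ is jointly continuous and $x\mapsto\ominus x$ is continuous. All topological gyrogroups are assumed to be $T_1$ spaces. A subgyrogroup of a gyrogroup is a nonempty subset closed under $\oplus$ and $\ominus$; a subgyrogroup of a topological gyrogroup carries the subspace topology. A $P$-space is a space in which every $G_\delta$-set is open. A $P$-gyrogroup is a topological gyrogroup whose underlying space is a $P$-space. A topological gyrogroup $G$ is Raĭkov complete if, whenever $G$ is a dense subgyrogroup (with the subspace topology) of a topological gyrogroup $H$, one has $G=H$. *)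

theory Defs
  imports "HOL-Analysis.Analysis" "HOL-Algebra.Bij"
begin

(* The HOL-Algebra record type "monoid" only supplies the signature (carrier, operation,
   identity element); no associativity is assumed.  The inverse "inv" is the library's m_inv,
   a definite description of the two-sided inverse, so it is the gyrogroup inverse as soon as
   that inverse is unique.  Elements of "auto G" are extensional, hence the equation of
   functions in gyr_ex says exactly that the two automorphisms agree on the carrier. *)

locale gyrogroup =
  fixes G (structure)
  assumes mult_closed: "\<lbrakk>x \<in> carrier G; y \<in> carrier G\<rbrakk> \<Longrightarrow> x \<otimes> y \<in> carrier G"
    and one_closed: "\<one> \<in> carrier G"
    and one_identity: "a \<in> carrier G \<Longrightarrow> \<one> \<otimes> a = a \<and> a \<otimes> \<one> = a"
    and one_unique:
      "\<lbrakk>e \<in> carrier G; \<And>a. a \<in> carrier G \<Longrightarrow> e \<otimes> a = a \<and> a \<otimes> e = a\<rbrakk> \<Longrightarrow> e = \<one>"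
    and inverse_ex1:
      "x \<in> carrier G \<Longrightarrow> \<exists>!y. y \<in> carrier G \<and> y \<otimes> x = \<one> \<and> x \<otimes> y = \<one>"
    and gyr_ex:
      "\<exists>gyr.
        (\<forall>x \<in> carrier G. \<forall>y \<in> carrier G.
          gyr x y \<in> auto G \<and>
          (\<forall>z \<in> carrier G. x \<otimes> (y \<otimes> z) = (x \<otimes> y) \<otimes> gyr x y z)) \<and>
        (\<forall>x \<in> carrier G. \<forall>y \<in> carrier G. gyr (x \<otimes> y) y = gyr x y)"

lemma (in gyrogroup) inv_in_carrier:
  assumes "x \<in> carrier G"
  shows "inv x \<in> carrier G" and "inv x \<otimes> x = \<one>" and "x \<otimes> inv x = \<one>"
proof -
  have "\<exists>!y. y \<in> carrier G \<and> x \<otimes> y = \<one> \<and> y \<otimes> x = \<one>"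
    using inverse_ex1[OF assms] by metis
  from theI'[OF this]
  show "inv x \<in> carrier G" "inv x \<otimes> x = \<one>" "x \<otimes> inv x = \<one>"
    unfolding m_inv_def by auto
qed

locale topological_gyrogroup = gyrogroup G for G (structure) and T +
  assumes topspace_eq: "topspace T = carrier G"
    and continuous_mult:
      "continuous_map (prod_topology T T) T (\<lambda>(x, y). x \<otimes> y)"
    and continuous_inv: "continuous_map T T (\<lambda>x. inv x)"
    and t1: "t1_space T"

definition P_space :: "'a topology \<Rightarrow> bool" where
  "P_space X \<longleftrightarrow> (\<forall>S. gdelta_in X S \<longrightarrow> openin X S)"

locale P_gyrogroup = topological_gyrogroup +
  assumes P_space: "P_space T"

definition subgyrogroup :: "'a set \<Rightarrow> ('a, 'b) monoid_scheme \<Rightarrow> bool" where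
  "subgyrogroup K H \<longleftrightarrow>
    K \<noteq> {} \<and> K \<subseteq> carrier H \<and>
    (\<forall>x \<in> K. \<forall>y \<in> K. x \<otimes>\<^bsub>H\<^esub> y \<in> K) \<and>
    (\<forall>x \<in> K. inv\<^bsub>H\<^esub> x \<in> K)"

(* "G is a dense subgyrogroup of H" is meant up to isomorphism of topological gyrogroups:
   the copy K of G inside H carries the operation and the topology inherited from H.
   A HOL formula cannot quantify over types, so the element type 'h of the candidate
   extensions H is a parameter; completeness is the statement for every type 'h.
   Lemma raikov_complete_superset is the case of an actual inclusion. *)
definition raikov_complete ::
  "'h itself \<Rightarrow> ('a, 'b) monoid_scheme \<Rightarrow> 'a topology \<Rightarrow> bool" where
  "raikov_complete _ G T \<longleftrightarrow>
    (\<forall>(H :: 'h monoid) S K f.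
      topological_gyrogroup H S \<and> subgyrogroup K H \<and> S closure_of K = topspace S \<and>
      f \<in> iso G (H\<lparr>carrier := K\<rparr>) \<and> homeomorphic_map T (subtopology S K) f
      \<longrightarrow> K = carrier H)"

lemma raikov_complete_superset:
  fixes H :: "'a monoid"
  assumes "raikov_complete TYPE('a) (H\<lparr>carrier := K\<rparr>) (subtopology S K)"
    and "topological_gyrogroup H S" and "subgyrogroup K H"
    and "S closure_of K = topspace S"
  shows "K = carrier H"
proof -
  have "id \<in> iso (H\<lparr>carrier := K\<rparr>) (H\<lparr>carrier := K\<rparr>)"
    by (auto simp: iso_def hom_def)
  moreover have "homeomorphic_map (subtopology S K) (subtopology S K) id"
    by simp
  ultimately show ?thesis
    using assms unfolding raikov_complete_def by blast
qed

end

theory Submission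
  imports Defs
begin

text \<open>
  If \<open>K\<close> is a dense subgyrogroup of \<open>H\<close> and a \<open>P\<close>-space, then by regularity of \<open>H\<close> every
  \<open>G\<^sub>\<delta>\<close>-set of \<open>H\<close> containing a point of \<open>K\<close> is a neighbourhood of that point, and left
  translations carry this to all points: \<open>H\<close> is itself a \<open>P\<close>-space. In a Hausdorff \<open>P\<close>-space
  every Lindelof subspace is closed, by the argument which shows that compact subsets of
  Hausdorff spaces are closed. So \<open>K\<close> is both dense and closed.
\<close>

lemma gdelta_in_continuous_map_preimage:
  assumes "continuous_map X Y f" "gdelta_in Y S"
  shows "gdelta_in X {x \<in> topspace X. f x \<in> S}"
proof -
  obtain C where C: "\<And>n. openin Y (C n)" "\<And>n. C (Suc n) \<subseteq> C n" "\<Inter>(range C) = S"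
    using assms(2) unfolding gdelta_in_descending by metis
  show ?thesis
    unfolding gdelta_in_descending
  proof (intro exI conjI allI)
    show "openin X {x \<in> topspace X. f x \<in> C n}" for n
      using assms(1) C(1) by (rule openin_continuous_map_preimage)
    show "{x \<in> topspace X. f x \<in> C (Suc n)} \<subseteq> {x \<in> topspace X. f x \<in> C n}" for n
      using C(2) by blast
    show "(\<Inter>n. {x \<in> topspace X. f x \<in> C n}) = {x \<in> topspace X. f x \<in> S}"
      unfolding C(3)[symmetric] by blast
  qed
qed

lemma P_space_homeomorphic_map:
  assumes "homeomorphic_map X Y f" "P_space X"
  shows "P_space Y"
  unfolding P_space_def
proof (intro allI impI)
  fix S assume S: "gdelta_in Y S"
  let ?U = "{x \<in> topspace X. f x \<in> S}"
  have "openin X ?U"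
    using assms S gdelta_in_continuous_map_preimage homeomorphic_imp_continuous_map
    unfolding P_space_def by blast
  then have "openin Y (f ` ?U)"
    using assms(1) homeomorphic_map_openness_eq by blast
  moreover have "f ` ?U = S"
    using homeomorphic_imp_surjective_map[OF assms(1)] gdelta_in_subset[OF S] by force
  ultimately show "openin Y S" by simp
qed

text \<open>The \<open>P\<close>-property is available on \<open>K\<close> only, so it yields an
  open \<open>W\<close> that is known to agree with \<open>\<Inter>(range U)\<close> merely on
  \<open>K\<close>. The closed sets \<open>V n\<close> between \<open>U n\<close> and
  \<open>C n\<close>, supplied by regularity, are what bounds \<open>W\<close> outside
  \<open>K\<close>.\<close>

lemma dense_P_subspace_gdelta_nhd:
  assumes "regular_space X" "X closure_of K = topspace X"
    and "P_space (subtopology X K)" "gdelta_in X S" "x \<in> S" "x \<in> K"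
  obtains W where "openin X W" "x \<in> W" "W \<subseteq> S"
proof -
  obtain C :: "nat \<Rightarrow> _" where C: "\<And>n. openin X (C n)" "\<Inter>(range C) = S"
    using assms(4) unfolding gdelta_in_descending by metis
  have "\<exists>U V. openin X U \<and> closedin X V \<and> x \<in> U \<and> U \<subseteq> V \<and> V \<subseteq> C n" for n
  proof -
    have "x \<in> C n" using C(2) \<open>x \<in> S\<close> by blast
    then show ?thesis
      using assms(1) C(1)[of n]
      unfolding neighbourhood_base_of_closedin[symmetric] neighbourhood_base_of by simp
  qed
  then obtain U V where UV: "\<And>n. openin X (U n)" "\<And>n. closedin X (V n)" "\<And>n. x \<in> U n"
    "\<And>n. U n \<subseteq> V n" "\<And>n. V n \<subseteq> C n"
    by metis
  have "gdelta_in X (\<Inter>(range U))"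
    by (rule gdelta_in_Inter) (use UV(1) open_imp_gdelta_in in auto)
  then have "openin (subtopology X K) (\<Inter>(range U) \<inter> K)"
    using assms(3) unfolding P_space_def gdelta_in_subtopology by blast
  then obtain W where W: "openin X W" "\<Inter>(range U) \<inter> K = W \<inter> K"
    unfolding openin_subtopology by blast
  \<comment> \<open>As \<open>K\<close> is dense and \<open>W\<close> is open, \<open>W\<close> lies
    in the closure of \<open>W \<inter> K\<close>, a set that is contained in the closed set
    \<open>V n\<close>.\<close>
  have "W \<subseteq> V n" for n
  proof -
    have "W \<subseteq> X closure_of (W \<inter> K)"
      using openin_Int_closure_of_subset[OF W(1), of K] openin_subset[OF W(1)] assms(2) by auto
    also have "\<dots> \<subseteq> V n"
      by (rule closure_of_minimal) (use UV W in blast)+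
    finally show ?thesis .
  qed
  then have "W \<subseteq> S" using UV(5) C(2) by blast
  moreover have "x \<in> W" using UV(3) W(2) \<open>x \<in> K\<close> by blast
  ultimately show thesis using that W(1) by blast
qed

text \<open>Compared with the compact case, countable subcovers replace finite ones, and the
  \<open>P\<close>-property keeps the countable intersection of the neighbourhoods
  \<open>V k\<close> of \<open>y\<close> open.\<close>

lemma Lindelof_subspace_closedin:
  assumes "Hausdorff_space X" "P_space X"
    and "Lindelof_space (subtopology X K)" "K \<subseteq> topspace X"
  shows "closedin X K"
proof -
  have "\<exists>W. openin X W \<and> y \<in> W \<and> W \<subseteq> topspace X - K" if y: "y \<in> topspace X - K" for y
  proof -
    have "\<exists>U V. openin X U \<and> openin X V \<and> k \<in> U \<and> y \<in> V \<and> disjnt U V" if "k \<in> K" for k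
    proof -
      have "k \<in> topspace X" "y \<in> topspace X" "k \<noteq> y" using assms(4) y that by auto
      then show ?thesis using assms(1) unfolding Hausdorff_space_def by simp
    qed
    then obtain U V where UV: "\<And>k. k \<in> K \<Longrightarrow> openin X (U k)" "\<And>k. k \<in> K \<Longrightarrow> openin X (V k)"
      "\<And>k. k \<in> K \<Longrightarrow> k \<in> U k" "\<And>k. k \<in> K \<Longrightarrow> y \<in> V k" "\<And>k. k \<in> K \<Longrightarrow> disjnt (U k) (V k)"
      by metis
    have "\<exists>\<V>. countable \<V> \<and> \<V> \<subseteq> (\<lambda>k. K \<inter> U k) ` K \<and> \<Union>\<V> = topspace (subtopology X K)"
      by (rule Lindelof_spaceD[OF assms(3)])
        (use UV assms(4) in \<open>auto simp: openin_subtopology_Int2\<close>)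
    then obtain N where N: "countable N" "N \<subseteq> K"
      "(\<Union>k\<in>N. K \<inter> U k) = topspace (subtopology X K)"
      unfolding ex_countable_subset_image by metis
    then have KN: "K \<subseteq> \<Union>(U ` N)"
      using assms(4) by fastforce
    \<comment> \<open>Inserting \<open>topspace X\<close> keeps the family nonempty when
      \<open>N\<close> is empty, as \<open>gdelta_in_Inter\<close> demands, and makes
      \<open>W\<close> a subset of the space.\<close>
    define W where "W = \<Inter>(insert (topspace X) (V ` N))"
    have "gdelta_in X W"
      unfolding W_def
    proof (rule gdelta_in_Inter)
      show "gdelta_in X Z" if "Z \<in> insert (topspace X) (V ` N)" for Z
        using that N(2) UV(2) open_imp_gdelta_in by blast
    qed (use N(1) in auto)
    then have "openin X W" using assms(2) unfolding P_space_def by blast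
    moreover have "y \<in> W" using y N(2) UV(4) unfolding W_def by auto
    moreover have "W \<subseteq> topspace X - K"
    proof
      fix w assume w: "w \<in> W"
      have "w \<notin> K"
      proof
        assume "w \<in> K"
        then obtain k where "k \<in> N" "w \<in> U k" using KN by blast
        moreover from this w have "w \<in> V k" unfolding W_def by simp
        ultimately show False using N(2) UV(5)[of k] unfolding disjnt_iff by blast
      qed
      then show "w \<in> topspace X - K" using w unfolding W_def by simp
    qed
    ultimately show ?thesis by blast
  qed
  then have "openin X (topspace X - K)" by (subst openin_subopen) blast
  then show ?thesis using assms(4) by (simp add: closedin_def)
qed

context gyrogroup
begin

lemma inv_inv:
  assumes "x \<in> carrier G"
  shows "inv (inv x) = x"
  using inverse_ex1[OF inv_in_carrier(1)[OF assms]] inv_in_carrier assms by metis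

text \<open>Gyroassociativity turns the left side into \<open>gyr (inv a) a b\<close>, so it remains
  to see that this gyration fixes \<open>b\<close>.\<close>

lemma inv_mult_cancel_left:
  assumes a: "a \<in> carrier G" and b: "b \<in> carrier G"
  shows "inv a \<otimes> (a \<otimes> b) = b"
proof -
  obtain gyr where aut: "\<And>x y. x \<in> carrier G \<Longrightarrow> y \<in> carrier G \<Longrightarrow> gyr x y \<in> auto G"
    and gyr: "\<And>x y z. x \<in> carrier G \<Longrightarrow> y \<in> carrier G \<Longrightarrow> z \<in> carrier G \<Longrightarrow>
      x \<otimes> (y \<otimes> z) = (x \<otimes> y) \<otimes> gyr x y z"
    and loop: "\<And>x y. x \<in> carrier G \<Longrightarrow> y \<in> carrier G \<Longrightarrow> gyr (x \<otimes> y) y = gyr x y"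
    using gyr_ex by metis
  note ia = inv_in_carrier[OF a]
  have bij: "bij_betw (gyr x y) (carrier G) (carrier G)"
    if "x \<in> carrier G" "y \<in> carrier G" for x y
    using aut[OF that] by (simp add: auto_def Bij_def)
  let ?g = "gyr (inv a) a"
  have gin: "?g z \<in> carrier G" if "z \<in> carrier G" for z
    using bij_betwE[OF bij[OF ia(1) a]] that by blast
  have g: "inv a \<otimes> (a \<otimes> z) = ?g z" if "z \<in> carrier G" for z
    using gyr[OF ia(1) a that] ia(2) one_identity[OF gin[OF that]] by simp
  \<comment> \<open>The loop law with \<open>inv a \<otimes> a = \<one>\<close>. Hence
    \<open>?g\<close> is also the gyration that arises in reassociating
    \<open>\<one> \<otimes> (a \<otimes> b)\<close>.\<close>
  have "?g = gyr \<one> a"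
    using loop[OF ia(1) a] ia(2) by simp
  then have "a \<otimes> b = a \<otimes> ?g b"
    using gyr[OF one_closed a b] one_identity a b mult_closed by metis
  \<comment> \<open>Multiply by \<open>inv a\<close> on the left and use \<open>g\<close> on both
    sides; injectivity of the automorphism \<open>?g\<close> then removes one application.\<close>
  then have "?g b = ?g (?g b)"
    using g b gin by metis
  then have "?g b = b"
    using bij_betw_imp_inj_on[OF bij[OF ia(1) a]] b gin by (metis inj_onD)
  then show ?thesis using g[OF b] by simp
qed

lemma mult_inv_cancel_left:
  assumes "a \<in> carrier G" "b \<in> carrier G"
  shows "a \<otimes> (inv a \<otimes> b) = b"
  using inv_mult_cancel_left[of "inv a" b] assms inv_in_carrier inv_inv by simp

end

context topological_gyrogroup
begin

lemma continuous_map_mult: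
  assumes "continuous_map X T f" "continuous_map X T g"
  shows "continuous_map X T (\<lambda>x. f x \<otimes> g x)"
  using continuous_map_compose[OF continuous_map_pairedI[OF assms] continuous_mult]
  by (simp add: o_def)

lemma continuous_map_left_translation:
  "a \<in> carrier G \<Longrightarrow> continuous_map T T (\<lambda>x. a \<otimes> x)"
  by (rule continuous_map_mult) (auto simp: topspace_eq)

text \<open>
  If \<open>A \<otimes> B \<subseteq> W\<close> for neighbourhoods \<open>A\<close> of \<open>x\<close> and \<open>B\<close> of \<open>\<one>\<close>, then the closure of \<open>A\<close> lies
  in \<open>W\<close>: for \<open>z\<close> in it, a point \<open>w \<in> A\<close> close to \<open>z\<close> gives \<open>z = w \<otimes> (inv w \<otimes> z) \<in> A \<otimes> B\<close>.
\<close>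
lemma regular_space: "regular_space T"
  unfolding neighbourhood_base_of_closedin[symmetric] neighbourhood_base_of
proof (intro allI impI, elim conjE)
  fix W x assume W: "openin T W" "x \<in> W"
  then have x: "x \<in> carrier G" using openin_subset topspace_eq by blast
  let ?P = "{p \<in> topspace (prod_topology T T). (case p of (u, v) \<Rightarrow> u \<otimes> v) \<in> W}"
  have "openin (prod_topology T T) ?P"
    by (rule openin_continuous_map_preimage[OF continuous_mult W(1)])
  moreover have "(x, \<one>) \<in> ?P"
    using W x one_closed one_identity[OF x] topspace_eq by simp
  ultimately obtain A B where AB: "openin T A" "openin T B" "x \<in> A" "\<one> \<in> B" "A \<times> B \<subseteq> ?P"
    unfolding openin_prod_topology_alt by meson
  have "T closure_of A \<subseteq> W"
  proof
    fix z assume z: "z \<in> T closure_of A"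
    then have zc: "z \<in> carrier G" using in_closure_of topspace_eq by metis
    let ?N = "{w \<in> topspace T. inv w \<otimes> z \<in> B}"
    have "continuous_map T T (\<lambda>w. inv w \<otimes> z)"
      by (rule continuous_map_mult[OF continuous_inv]) (use zc topspace_eq in auto)
    then have "openin T ?N"
      using AB(2) by (rule openin_continuous_map_preimage)
    moreover have "z \<in> ?N"
      using zc AB(4) topspace_eq inv_in_carrier(2)[OF zc] by simp
    ultimately obtain w where w: "w \<in> A" "w \<in> ?N"
      using z[unfolded in_closure_of, THEN conjunct2, rule_format, of ?N] by auto
    then have "w \<otimes> (inv w \<otimes> z) \<in> W" using AB(5) by auto
    then show "z \<in> W" using w zc topspace_eq mult_inv_cancel_left by auto
  qed
  then show "\<exists>U V. openin T U \<and> closedin T V \<and> x \<in> U \<and> U \<subseteq> V \<and> V \<subseteq> W"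
    using AB closure_of_subset[OF openin_subset[OF AB(1)]] closedin_closure_of by metis
qed

lemma Hausdorff_space: "Hausdorff_space T"
  using regular_t1_imp_Hausdorff_space regular_space t1 by blast

lemma P_space_if_dense_P_subspace:
  assumes "\<one> \<in> K" "T closure_of K = topspace T" "P_space (subtopology T K)"
  shows "P_space T"
  unfolding P_space_def
proof (intro allI impI)
  fix S assume S: "gdelta_in T S"
  have "\<exists>W. openin T W \<and> x \<in> W \<and> W \<subseteq> S" if "x \<in> S" for x
  proof -
    have x: "x \<in> carrier G" using that gdelta_in_subset[OF S] topspace_eq by blast
    \<comment> \<open>The neighbourhood lemma needs a point of \<open>K\<close>, so \<open>S\<close>
      is translated to move \<open>x\<close> to \<open>\<one>\<close>.\<close>
    let ?S = "{y \<in> topspace T. x \<otimes> y \<in> S}"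
    have "gdelta_in T ?S"
      using continuous_map_left_translation[OF x] S by (rule gdelta_in_continuous_map_preimage)
    moreover have "\<one> \<in> ?S"
      using that one_closed one_identity[OF x] topspace_eq by simp
    ultimately obtain W where W: "openin T W" "\<one> \<in> W" "W \<subseteq> ?S"
      by (rule dense_P_subspace_gdelta_nhd[OF regular_space assms(2,3) _ _ assms(1)])
    \<comment> \<open>This is the translate \<open>x \<otimes> W\<close>, written as a preimage
      under translation by \<open>inv x\<close> so that continuity gives its openness.\<close>
    let ?W = "{w \<in> topspace T. inv x \<otimes> w \<in> W}"
    have "openin T ?W"
      using continuous_map_left_translation[OF inv_in_carrier(1)[OF x]] W(1)
      by (rule openin_continuous_map_preimage)
    moreover have "x \<in> ?W"
      using x W(2) inv_in_carrier(2)[OF x] topspace_eq by simp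
    moreover have "?W \<subseteq> S"
    proof
      fix w assume w: "w \<in> ?W"
      then have "x \<otimes> (inv x \<otimes> w) \<in> S" using W(3) by blast
      then show "w \<in> S" using w x topspace_eq mult_inv_cancel_left by simp
    qed
    ultimately show ?thesis by blast
  qed
  then show "openin T S" by (subst openin_subopen) blast
qed

end

theorem theorem4p9:
  fixes G :: "'a monoid" and T :: "'a topology"
  assumes "P_gyrogroup G T"
    and "Lindelof_space T"
  shows "raikov_complete TYPE('h) G T"
  unfolding raikov_complete_def
proof (intro allI impI, elim conjE)
  fix H :: "'h monoid" and S K f
  assume H: "topological_gyrogroup H S" and K: "subgyrogroup K H"
    and dense: "S closure_of K = topspace S"
    and f: "homeomorphic_map T (subtopology S K) f"
  interpret H: topological_gyrogroup H S by (rule H)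
  have KH: "K \<subseteq> topspace S"
    using K H.topspace_eq unfolding subgyrogroup_def by simp
  \<comment> \<open>For any element of the nonempty set \<open>K\<close>, its inverse and hence
    their product \<open>\<one>\<close> lie in \<open>K\<close>.\<close>
  have "\<one>\<^bsub>H\<^esub> \<in> K"
    using K H.inv_in_carrier unfolding subgyrogroup_def by (metis ex_in_conv subsetD)
  moreover have "P_space (subtopology S K)"
    using P_space_homeomorphic_map[OF f] assms(1)
    by (simp add: P_gyrogroup_def P_gyrogroup_axioms_def)
  ultimately have "P_space S"
    using H.P_space_if_dense_P_subspace dense by blast
  moreover have "Lindelof_space (subtopology S K)"
    using Lindelof_space_continuous_map_image[OF assms(2) homeomorphic_imp_continuous_map[OF f]]
      homeomorphic_imp_surjective_map[OF f] by blast
  ultimately have "closedin S K"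
    using Lindelof_subspace_closedin[OF H.Hausdorff_space _ _ KH] by blast
  then show "K = carrier H"
    using dense closure_of_closedin H.topspace_eq by metis
qed

end
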